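(* Let $\mathbb{M}$ be the free groupoid (free magma) on one generator. If $L\subseteq\mathbb{M}$ is a non-empty longitudinal subgroupoid, then there is an integer $p>0$ such that, as $n\to\infty$, $$\frac{|L|_{\leq n}}{|\mathbb{M}|_{\leq n}} \sim \frac{3}{\left(1-\frac{1}{4^p} \right)4^{1+(n \bmod p)}}.$$
   Context: A groupoid (magma) is a set with a binary operation, written $+$, with no axioms. $\mathbb{M}$ denotes the free groupoid on a single generator denoted $1$; its elements are $1, 1+1, 1+(1+1), (1+1)+1,\ldots$ (equivalently, finite planar binary trees). A subgroupoid is a subset closed under $+$. The length $\ell:\mathbb{M}\to\mathbb{N}$ is the unique function with $\ell(1)=1$ and $\ell(x+y)=\ell(x)+\ell(y)$, where $\mathbb{N}=\{1,2,3,\ldots\}$. A longitudinal subgroupoid is a subgroupoid of the form $L=\ell^{-1}(N)$, where $N$ is a subsemigroup of $(\mathbb{N},+)$. For $X\subseteq \mathbb{M}$, $|X|_n$ is the number of $x\in X$ with $\ell(x)=n$, and $|X|_{\leq n}=\sum_{k=1}^n |X|_k$. Here $n\bmod p\in\{0,1,\ldots,p-1\}$ is the remainder of $n$ modulo $p$, and $\sim$ denotes asymptotic equivalence of sequences in $n$ (the ratio of the two sides tends to $1$ as $n\to\infty$). *)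

theory Defs
  imports Complex_Main "HOL-Library.Landau_Symbols"
begin

text \<open>The free groupoid (magma) on one generator, as the term algebra: since a groupoid satisfies
  no axioms, its elements are exactly the planar binary trees.\<close>

datatype free_groupoid =
    Gen
  | Add free_groupoid free_groupoid  (infixl \<open>\<oplus>\<close> 65)

primrec len :: "free_groupoid \<Rightarrow> nat" where
  "len Gen = 1"
| "len (x \<oplus> y) = len x + len y"

definition subgroupoid :: "free_groupoid set \<Rightarrow> bool" where
  "subgroupoid X \<longleftrightarrow> (\<forall>x\<in>X. \<forall>y\<in>X. x \<oplus> y \<in> X)"

text \<open>Here the additive semigroup of natural numbers is \<open>{1, 2, 3, \<dots>}\<close>, whence the exclusion
  of \<open>0\<close>.\<close>

definition subsemigroup :: "nat set \<Rightarrow> bool" where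
  "subsemigroup N \<longleftrightarrow> N \<subseteq> {1..} \<and> (\<forall>a\<in>N. \<forall>b\<in>N. a + b \<in> N)"

definition longitudinal :: "free_groupoid set \<Rightarrow> bool" where
  "longitudinal L \<longleftrightarrow> subgroupoid L \<and> (\<exists>N. subsemigroup N \<and> L = len -` N)"

definition count_eq :: "free_groupoid set \<Rightarrow> nat \<Rightarrow> nat" where
  "count_eq X n = card {x \<in> X. len x = n}"

definition count_le :: "free_groupoid set \<Rightarrow> nat \<Rightarrow> nat" where
  "count_le X n = (\<Sum>k=1..n. count_eq X k)"

lemma len_pos: "len x \<ge> 1"
  by (induction x) auto

text \<open>There are finitely many elements of each length, so that \<open>card\<close> is a genuine count.\<close>

lemma finite_len_le: "finite {x. len x \<le> n}"
proof (induction n)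
  case 0
  have "{x. len x \<le> 0} = {}"
    using len_pos by (auto simp: Suc_le_eq)
  then show ?case by (simp only: finite.emptyI)
next
  case (Suc n)
  let ?A = "{x. len x \<le> n}"
  have "{x. len x \<le> Suc n} \<subseteq> insert Gen ((\<lambda>(x, y). x \<oplus> y) ` (?A \<times> ?A))"
  proof
    fix z assume z: "z \<in> {x. len x \<le> Suc n}"
    show "z \<in> insert Gen ((\<lambda>(x, y). x \<oplus> y) ` (?A \<times> ?A))"
    proof (cases z)
      case (Add x y)
      with z len_pos[of x] len_pos[of y] have "x \<in> ?A" "y \<in> ?A" by auto
      with Add show ?thesis by force
    qed simp
  qed
  then show ?case
    by (rule finite_subset) (use Suc in simp)
qed

lemma finite_len_eq: "finite {x \<in> X. len x = n}"
  by (rule finite_subset[OF _ finite_len_le[of n]]) auto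

end

theory Submission
  imports Defs "HOL-Computational_Algebra.Formal_Power_Series" "HOL-Real_Asymp.Real_Asymp"
begin

text \<open>The set \<open>N\<close> of lengths of \<open>L\<close> contains, from some point on, exactly the multiples of some
  \<open>p > 0\<close>. The generating function \<open>A\<close> of the numbers \<open>a\<^sub>n\<close> of elements of length \<open>n\<close> satisfies
  \<open>A = X + A\<^sup>2\<close>, hence \<open>(1 - 4 X) A' = 1 - 2 A\<close>, so that \<open>a\<^bsub>n+1\<^esub> / a\<^sub>n \<rightarrow> 4\<close>. Both cumulative counts
  therefore behave like geometric sums, dominated by their last terms: the one of \<open>L\<close> is
  asymptotic to \<open>a\<^sub>m / (1 - 1/4^p)\<close>, where \<open>m = n - n mod p\<close>, and the one of the whole groupoid
  to \<open>4/3 * a\<^sub>n\<close>, while \<open>a\<^sub>n\<close> is asymptotic to \<open>4^(n mod p) * a\<^sub>m\<close>.\<close>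

section \<open>Structure of subsemigroups of the positive integers\<close>

lemma subsemigroup_mult_mem:
  assumes "subsemigroup N" "a \<in> N" "k > 0"
  shows "k * a \<in> N"
  using \<open>k > 0\<close>
proof (induction k rule: nat_induct_non_zero)
  case (Suc k)
  then show ?case using assms by (auto simp: subsemigroup_def)
qed (use assms in simp)

text \<open>The period is the least positive difference \<open>d\<close> of two elements
  \<open>a\<close> and \<open>a + d\<close> of \<open>N\<close>. A nonzero remainder modulo
  \<open>d\<close> would produce a smaller difference, so \<open>d\<close> divides every element;
  conversely, sums of copies of \<open>a\<close> and \<open>a + d\<close> reach all large multiples
  of \<open>d\<close>.\<close>

lemma subsemigroup_eventually_multiples:
  assumes N: "subsemigroup N" and "N \<noteq> {}"
  obtains p B where "p > 0" "\<And>n. n \<ge> B \<Longrightarrow> n \<in> N \<longleftrightarrow> p dvd n"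
proof -
  have add: "x + y \<in> N" if "x \<in> N" "y \<in> N" for x y
    using N that by (auto simp: subsemigroup_def)
  have pos: "x > 0" if "x \<in> N" for x
    using N that by (auto simp: subsemigroup_def)
  define P where "P d \<longleftrightarrow> d > 0 \<and> (\<exists>a\<in>N. a + d \<in> N)" for d
  define d where "d = (LEAST d. P d)"
  \<comment> \<open>\<open>x + x\<close> and \<open>x\<close> differ by \<open>x\<close>. Hence some
    difference exists, and \<open>d\<close> is at most every element of \<open>N\<close>.\<close>
  have self: "P x" if "x \<in> N" for x
    using that add pos by (auto simp: P_def)
  have "P d"
    unfolding d_def using self \<open>N \<noteq> {}\<close> by (metis LeastI ex_in_conv)
  then obtain a where d: "d > 0" and a: "a \<in> N" "a + d \<in> N"
    by (auto simp: P_def)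
  have least: "d \<le> e" if "P e" for e
    unfolding d_def using that by (rule Least_le)
  have dvd: "d dvd x" if x: "x \<in> N" for x
  proof (rule ccontr)
    assume "\<not> d dvd x"
    then have r: "x mod d > 0" by (simp add: mod_greater_zero_iff_not_dvd)
    have q: "x div d > 0"
      using least[OF self[OF x]] d by (simp add: div_greater_zero_iff)
    \<comment> \<open>These two elements of \<open>N\<close> differ by exactly
      \<open>x mod d\<close>, which is smaller than \<open>d\<close>.\<close>
    have "(x div d) * (a + d) \<in> N" "(x div d) * a + x \<in> N"
      using subsemigroup_mult_mem[OF N _ q] a add x by auto
    moreover have "(x div d) * a + x = (x div d) * (a + d) + x mod d"
      by (simp add: algebra_simps)
    ultimately have "P (x mod d)"
      using r unfolding P_def by metis
    then show False using least d by (meson mod_less_divisor not_le)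
  qed
  obtain m where m: "a = d * m" using dvd[OF a(1)] by blast
  with pos[OF a(1)] have mpos: "m > 0" by simp
  \<comment> \<open>With \<open>n = d * (m * t + s)\<close> and \<open>a = d * m\<close>, one has
    \<open>n = t * a + s * d = (t - s) * a + s * (a + d)\<close>. The bound \<open>m * m\<close>
    forces \<open>s < m \<le> t\<close>, so the coefficient \<open>u = t - s\<close> is
    positive.\<close>
  have "n \<in> N" if n: "n \<ge> d * (m * m)" "d dvd n" for n
  proof -
    obtain j where j: "n = d * j" using n by blast
    define s t where "s = j mod m" and "t = j div m"
    have "j \<ge> m * m" using n j d by simp
    then have "m \<le> t"
      unfolding t_def using mpos by (metis div_le_mono nonzero_mult_div_cancel_left less_not_refl)
    moreover have "s < m" unfolding s_def using mpos by simp
    ultimately obtain u where u: "t = s + u" "u > 0"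
      by (metis less_imp_add_positive less_le_trans)
    have "j = m * t + s" by (simp add: s_def t_def)
    then have "n = u * a + s * (a + d)"
      unfolding j m u by (simp add: algebra_simps)
    moreover have "u * a \<in> N"
      using subsemigroup_mult_mem[OF N] a u by simp
    ultimately show ?thesis
      using subsemigroup_mult_mem[OF N a(2), of s] add by (cases "s = 0") auto
  qed
  then show ?thesis using that[of d "d * (m * m)"] d dvd by blast
qed

section \<open>Generating function and growth of the counts\<close>

definition catalan_fps :: "real fps" where
  "catalan_fps = Abs_fps (\<lambda>n. real (count_eq UNIV n))"

text \<open>The range \<open>0..n\<close> matches the Cauchy product; the end terms are empty, since
  no element has length 0.\<close>

lemma set_len_eq:
  "{x. len x = n} = (if n = 1 then {Gen} else {}) \<union>
     (\<lambda>(x, y). x \<oplus> y) ` (\<Union>i\<in>{0..n}. {x. len x = i} \<times> {y. len y = n - i})"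
  (is "_ = ?R")
proof (intro set_eqI iffI)
  fix x assume "x \<in> {x. len x = n}"
  then show "x \<in> ?R" by (cases x) (auto simp: image_iff)
qed (auto split: if_splits)

lemma count_eq_UNIV_rec:
  "count_eq UNIV n = (if n = 1 then 1 else 0) +
     (\<Sum>i=0..n. count_eq UNIV i * count_eq UNIV (n - i))"
proof -
  have fin: "finite {x. len x = i}" for i
    using finite_len_eq[of UNIV i] by simp
  let ?P = "\<Union>i\<in>{0..n}. {x. len x = i} \<times> {y. len y = n - i}"
  let ?f = "\<lambda>(x, y). x \<oplus> y"
  have "card {x. len x = n} = card (if n = 1 then {Gen} else {}) + card (?f ` ?P)"
    by (subst set_len_eq, rule card_Un_disjoint) (auto simp: fin)
  also have "card (?f ` ?P) = card ?P"
    by (rule card_image) (auto simp: inj_on_def)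
  also have "\<dots> = (\<Sum>i=0..n. card ({x. len x = i} \<times> {y. len y = n - i}))"
    by (rule card_UN_disjoint) (auto simp: fin)
  finally show ?thesis by (simp add: count_eq_def card_cartesian_product)
qed

lemma catalan_fps_eq: "catalan_fps = fps_X + catalan_fps * catalan_fps"
proof (rule fps_ext)
  fix n
  show "fps_nth catalan_fps n = fps_nth (fps_X + catalan_fps * catalan_fps) n"
    unfolding catalan_fps_def fps_mult_nth fps_add_nth Abs_fps_inverse
    by (simp add: fps_X_def count_eq_UNIV_rec[of n])
qed

text \<open>Differentiating \<open>A = X + A * A\<close> gives \<open>(1 - 2 * A) * A' = 1\<close>,
  and completing the square gives \<open>(1 - 2 * A)^2 = 1 - 4 * X\<close>.\<close>

lemma catalan_fps_deriv: "(1 - 4 * fps_X) * fps_deriv catalan_fps = 1 - 2 * catalan_fps"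
proof -
  let ?A = catalan_fps
  have "fps_deriv ?A = 1 + 2 * ?A * fps_deriv ?A"
    by (subst catalan_fps_eq) (simp add: algebra_simps)
  moreover have "?A = fps_X + ?A * ?A" by (rule catalan_fps_eq)
  ultimately show ?thesis by algebra
qed

text \<open>Compares the coefficients of index \<open>n\<close> in the differential equation;
  \<open>n > 0\<close> removes the constant 1 on its right-hand side.\<close>

lemma count_eq_UNIV_Suc:
  assumes "n > 0"
  shows "(real n + 1) * count_eq UNIV (Suc n) = (4 * real n - 2) * count_eq UNIV n"
proof -
  have X: "4 * fps_X * F = fps_const 4 * (fps_X * F)"
    and two: "2 * F = fps_const 2 * F" for F :: "real fps"
    by (simp_all add: fps_numeral_fps_const mult.assoc)
  have "fps_nth (fps_deriv catalan_fps - fps_const 4 * (fps_X * fps_deriv catalan_fps)) n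
      = fps_nth (1 - fps_const 2 * catalan_fps) n"
    using catalan_fps_deriv by (simp add: left_diff_distrib X two)
  then show ?thesis
    using assms by (simp add: catalan_fps_def algebra_simps)
qed

lemma count_eq_UNIV_pos:
  assumes "n > 0"
  shows "count_eq UNIV n > 0"
  using assms
proof (induction n rule: nat_induct_non_zero)
  case 1
  show ?case by (subst count_eq_UNIV_rec) simp
next
  case (Suc n)
  then have "(4 * real n - 2) * count_eq UNIV n > 0" by simp
  then show ?case
    using count_eq_UNIV_Suc[OF \<open>n > 0\<close>] by (metis gr0I mult_zero_right of_nat_0 less_irrefl)
qed

text \<open>The one-step quotient \<open>(4 * n - 2) / (n + 1)\<close> tends to 4, and
  \<open>i\<close> such steps multiply.\<close>

lemma count_eq_UNIV_ratio:
  "(\<lambda>n. real (count_eq UNIV (n + i)) / real (count_eq UNIV n)) \<longlonglongrightarrow> 4 ^ i"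
proof (induction i)
  case 0
  have "\<forall>\<^sub>F n in sequentially. 1 = real (count_eq UNIV (n + 0)) / real (count_eq UNIV n)"
    using eventually_gt_at_top[of 0]
    by eventually_elim (use count_eq_UNIV_pos in force)
  then show ?case by (auto intro: Lim_transform_eventually)
next
  case (Suc i)
  have "(\<lambda>n. (4 * real (n + i) - 2) / (real (n + i) + 1)) \<longlonglongrightarrow> 4"
    by real_asymp
  from tendsto_mult[OF this Suc.IH]
  have lim: "(\<lambda>n. (4 * real (n + i) - 2) / (real (n + i) + 1) *
      (real (count_eq UNIV (n + i)) / real (count_eq UNIV n))) \<longlonglongrightarrow> 4 ^ Suc i"
    by simp
  have "\<forall>\<^sub>F n in sequentially. (4 * real (n + i) - 2) / (real (n + i) + 1) *
      (real (count_eq UNIV (n + i)) / real (count_eq UNIV n))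
      = real (count_eq UNIV (n + Suc i)) / real (count_eq UNIV n)"
    using eventually_gt_at_top[of 0]
  proof eventually_elim
    case (elim n)
    then have "real (count_eq UNIV (Suc (n + i)))
        = (4 * real (n + i) - 2) * count_eq UNIV (n + i) / (real (n + i) + 1)"
      using count_eq_UNIV_Suc[of "n + i"]
      by (subst eq_divide_eq) (auto simp: mult.commute)
    then show ?case by simp
  qed
  with lim show ?case by (rule Lim_transform_eventually)
qed

section \<open>Partial sums dominated by their last terms\<close>

text \<open>Once \<open>d n < (1 - c) * (r / 2)\<close>, iterating the inequality accumulates a
  geometric series of errors bounded by \<open>r / 2\<close>, while the initial error is multiplied
  by \<open>c ^ k\<close>.\<close>

lemma contraction_tendsto_0:
  fixes e d :: "nat \<Rightarrow> real"
  assumes c: "0 \<le> c" "c < 1" and d: "d \<longlonglongrightarrow> 0"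
    and step: "\<forall>\<^sub>F n in sequentially. \<bar>e (Suc n)\<bar> \<le> c * \<bar>e n\<bar> + d n"
  shows "e \<longlonglongrightarrow> 0"
proof (rule LIMSEQ_I)
  fix r :: real assume r: "0 < r"
  have "\<forall>\<^sub>F n in sequentially. d n < (1 - c) * (r / 2)"
    using d c r by (intro order_tendstoD) auto
  with step have "\<forall>\<^sub>F n in sequentially. \<bar>e (Suc n)\<bar> \<le> c * \<bar>e n\<bar> + (1 - c) * (r / 2)"
    by eventually_elim simp
  then obtain M where M: "\<And>n. n \<ge> M \<Longrightarrow> \<bar>e (Suc n)\<bar> \<le> c * \<bar>e n\<bar> + (1 - c) * (r / 2)"
    by (auto simp: eventually_sequentially)
  have bound: "\<bar>e (k + M)\<bar> \<le> c ^ k * \<bar>e M\<bar> + r / 2" for k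
  proof (induction k)
    case 0
    then show ?case using r by simp
  next
    case (Suc k)
    have "\<bar>e (Suc k + M)\<bar> \<le> c * \<bar>e (k + M)\<bar> + (1 - c) * (r / 2)"
      using M[of "k + M"] by simp
    also have "\<dots> \<le> c * (c ^ k * \<bar>e M\<bar> + r / 2) + (1 - c) * (r / 2)"
      using Suc c by (intro add_right_mono mult_left_mono) auto
    finally show ?case by (simp add: field_simps)
  qed
  have "(\<lambda>k. c ^ k * \<bar>e M\<bar>) \<longlonglongrightarrow> 0 * \<bar>e M\<bar>"
    using c by (intro tendsto_intros LIMSEQ_power_zero) auto
  then have "\<forall>\<^sub>F k in sequentially. c ^ k * \<bar>e M\<bar> < r / 2"
    using r by (intro order_tendstoD) auto
  then obtain K where K: "\<And>k. k \<ge> K \<Longrightarrow> c ^ k * \<bar>e M\<bar> < r / 2"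
    by (auto simp: eventually_sequentially)
  have "norm (e n - 0) < r" if "n \<ge> K + M" for n
    using bound[of "n - M"] K[of "n - M"] that by (simp add: le_diff_conv2)
  then show "\<exists>no. \<forall>n\<ge>no. norm (e n - 0) < r" by blast
qed

text \<open>The quotients \<open>u n = S n / b n\<close> satisfy
  \<open>u (Suc n) = 1 + q n * u n\<close> with \<open>q n\<close> tending to
  \<open>1 / r < 1\<close>, so they approach the fixed point \<open>t = 1 + t / r\<close>. The
  recurrence is only required eventually, because \<open>N\<close> is periodic only from some point
  on.\<close>

lemma geometric_partial_sums:
  fixes S b :: "nat \<Rightarrow> real"
  assumes step: "\<forall>\<^sub>F n in sequentially. S (Suc n) = S n + b (Suc n)"
    and pos: "\<forall>\<^sub>F n in sequentially. b n > 0"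
    and ratio: "(\<lambda>n. b (Suc n) / b n) \<longlonglongrightarrow> r" and r: "r > 1"
  shows "(\<lambda>n. S n / b n) \<longlonglongrightarrow> 1 / (1 - 1 / r)"
proof -
  define t where "t = 1 / (1 - 1 / r)"
  define q where "q n = b n / b (Suc n)" for n
  have q: "q \<longlonglongrightarrow> 1 / r"
    using tendsto_inverse[OF ratio] r by (simp add: q_def[abs_def] inverse_eq_divide)
  obtain c where c: "1 / r < c" "c < 1" using r dense[of "1 / r" 1] by auto
  moreover have "0 < 1 / r" using r by simp
  ultimately have c0: "0 \<le> c" by linarith
  have t: "t = 1 + 1 / r * t" using r by (simp add: t_def field_simps)
  have d: "(\<lambda>n. \<bar>q n - 1 / r\<bar> * \<bar>t\<bar>) \<longlonglongrightarrow> 0"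
    by (rule tendsto_eq_intros q refl)+ simp
  have "\<forall>\<^sub>F n in sequentially. b (Suc n) > 0" using pos by (rule eventually_compose_filterlim[OF _ filterlim_Suc])
  moreover have "\<forall>\<^sub>F n in sequentially. q n < c" using q c by (intro order_tendstoD) auto
  ultimately have "\<forall>\<^sub>F n in sequentially.
      \<bar>S (Suc n) / b (Suc n) - t\<bar> \<le> c * \<bar>S n / b n - t\<bar> + \<bar>q n - 1 / r\<bar> * \<bar>t\<bar>"
    using step pos
  proof eventually_elim
    case (elim n)
    then have "S (Suc n) / b (Suc n) = 1 + q n * (S n / b n)"
      by (simp add: q_def field_simps)
    then have "S (Suc n) / b (Suc n) - t = q n * (S n / b n - t) + (q n - 1 / r) * t"
      using t by (simp add: algebra_simps)
    then have "\<bar>S (Suc n) / b (Suc n) - t\<bar> \<le> \<bar>q n\<bar> * \<bar>S n / b n - t\<bar> + \<bar>q n - 1 / r\<bar> * \<bar>t\<bar>"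
      by (metis abs_mult abs_triangle_ineq)
    also have "\<bar>q n\<bar> * \<bar>S n / b n - t\<bar> \<le> c * \<bar>S n / b n - t\<bar>"
      using elim by (intro mult_right_mono) (auto simp: q_def)
    finally show ?case by simp
  qed
  from contraction_tendsto_0[OF c0 c(2) d this] show ?thesis
    unfolding t_def by (simp add: LIM_zero_iff)
qed

section \<open>Counting in longitudinal subgroupoids\<close>

lemma count_eq_longitudinal:
  "count_eq (len -` N) n = (if n \<in> N then count_eq UNIV n else 0)"
proof -
  have "{x \<in> len -` N. len x = n} = (if n \<in> N then {x \<in> UNIV. len x = n} else {})" by auto
  then show ?thesis unfolding count_eq_def by auto
qed

text \<open>Among the \<open>k \<le> p\<close> integers following \<open>p * j\<close>, only the
  last can be a multiple of \<open>p\<close>, and only if \<open>k = p\<close>.\<close>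

lemma sum_single_multiple:
  fixes f :: "nat \<Rightarrow> 'a::comm_monoid_add"
  assumes "0 < k" "k \<le> p" and zero: "\<And>i. \<not> p dvd i \<Longrightarrow> p * j < i \<Longrightarrow> f i = 0"
  shows "(\<Sum>i=1..p * j + k. f i) = (\<Sum>i=1..p * j. f i) + (if k = p then f (p * Suc j) else 0)"
proof -
  have "f i = (if i = p * Suc j then f (p * Suc j) else 0)"
    if "i \<in> {p * j + 1..p * j + k}" for i
  proof (cases "i = p * Suc j")
    case False
    have "\<not> p dvd i"
    proof
      assume "p dvd i"
      then obtain l where l: "i = p * l" by blast
      have "p * j < i" "i \<le> p * Suc j" using that \<open>k \<le> p\<close> by auto
      then have "j < l" "l \<le> Suc j"
        using assms(1,2) by (simp_all only: l mult_less_cancel1 mult_le_cancel1)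
      then have "l = Suc j" by simp
      with False l show False by simp
    qed
    then show ?thesis using zero that False by simp
  qed simp
  then have "(\<Sum>i=p * j + 1..p * j + k. f i)
      = (\<Sum>i=p * j + 1..p * j + k. if i = p * Suc j then f (p * Suc j) else 0)"
    by (rule sum.cong[OF refl])
  also have "\<dots> = (if k = p then f (p * Suc j) else 0)"
    using assms(1,2) by (subst sum.delta) auto
  finally show ?thesis using sum.ub_add_nat[of 1 "p * j" f k] by simp
qed

theorem theorem4p4:
  fixes L :: "free_groupoid set"
  assumes "longitudinal L" and "L \<noteq> {}"
  shows "\<exists>p::nat. p > 0 \<and>
    (\<lambda>n::nat. real (count_le L n) / real (count_le UNIV n))
      \<sim>[sequentially] (\<lambda>n. 3 / ((1 - 1 / 4 ^ p) * 4 ^ (1 + n mod p)))"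
proof -
  obtain N where N: "subsemigroup N" "L = len -` N"
    using assms by (auto simp: longitudinal_def)
  with assms have "N \<noteq> {}" by auto
  with N obtain p B where p: "p > 0" and B: "\<And>n. n \<ge> B \<Longrightarrow> n \<in> N \<longleftrightarrow> p dvd n"
    using subsemigroup_eventually_multiples by metis
  define a where "a n = real (count_eq UNIV n)" for n
  define m where "m n = p * (n div p)" for n
  have m_div: "filterlim (\<lambda>n. n div p) at_top sequentially"
    using p by (rule filterlim_at_top_div_const_nat)
  have m: "filterlim m at_top sequentially"
  proof (rule filterlim_at_top_mono[OF m_div])
    show "\<forall>\<^sub>F n in sequentially. n div p \<le> m n" using p by (simp add: m_def)
  qed
  have a_pos: "a n > 0" if "n > 0" for n
    using count_eq_UNIV_pos[OF that] by (simp add: a_def)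
  have a_ratio: "(\<lambda>n. a (n + i) / a n) \<longlonglongrightarrow> 4 ^ i" for i
    unfolding a_def by (rule count_eq_UNIV_ratio)
  have large: "\<forall>\<^sub>F j in sequentially. B \<le> p * j"
    using eventually_ge_at_top[of B] by eventually_elim (use p in \<open>auto intro: le_trans\<close>)
  \<comment> \<open>The case \<open>k = p\<close> gives the recurrence along multiples of
    \<open>p\<close>; the case \<open>k < p\<close> shows that the count stays constant between
    them.\<close>
  have step: "count_le L (p * j + k)
      = count_le L (p * j) + (if k = p then count_eq UNIV (p * Suc j) else 0)"
    if "B \<le> p * j" "0 < k" "k \<le> p" for j k
  proof -
    have "count_eq L (p * Suc j) = count_eq UNIV (p * Suc j)"
      using that(1) B[of "p * Suc j"] by (simp add: N count_eq_longitudinal)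
    moreover have "count_eq L i = 0" if "\<not> p dvd i" "p * j < i" for i
      using that \<open>B \<le> p * j\<close> B[of i] by (simp add: N count_eq_longitudinal)
    ultimately show ?thesis
      unfolding count_le_def using sum_single_multiple[OF that(2,3), of j "count_eq L"] by simp
  qed

  have limM: "(\<lambda>n. real (count_le UNIV n) / a n) \<longlonglongrightarrow> 1 / (1 - 1 / 4)"
  proof (rule geometric_partial_sums)
    show "\<forall>\<^sub>F n in sequentially. a n > 0"
      using eventually_gt_at_top[of 0] by eventually_elim (rule a_pos)
    show "(\<lambda>n. a (Suc n) / a n) \<longlonglongrightarrow> 4" using a_ratio[of 1] by simp
  qed (auto simp: count_le_def a_def)

  \<comment> \<open>Along the multiples of \<open>p\<close>, consecutive terms
    \<open>a (p * j)\<close> have limiting ratio \<open>4 ^ p\<close>.\<close>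
  have "(\<lambda>j. real (count_le L (p * j)) / a (p * j)) \<longlonglongrightarrow> 1 / (1 - 1 / 4 ^ p)"
  proof (rule geometric_partial_sums)
    show "\<forall>\<^sub>F j in sequentially. a (p * j) > 0"
      using eventually_gt_at_top[of 0] by eventually_elim (use p in \<open>auto intro: a_pos\<close>)
    have "filterlim (\<lambda>j. p * j) at_top sequentially"
      using p by (rule mult_nat_left_at_top)
    from filterlim_compose[OF a_ratio this, of p]
    show "(\<lambda>j. a (p * Suc j) / a (p * j)) \<longlonglongrightarrow> 4 ^ p" by (simp add: add.commute)
    show "\<forall>\<^sub>F j in sequentially.
        real (count_le L (p * Suc j)) = real (count_le L (p * j)) + a (p * Suc j)"
      using large
    proof eventually_elim
      case (elim j)
      then show ?case using step[of j p] p by (simp add: a_def add.commute)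
    qed
    show "(4::real) ^ p > 1" using p by (simp add: one_less_power)
  qed
  from filterlim_compose[OF this m_div]
  have limL: "(\<lambda>n. real (count_le L (m n)) / a (m n)) \<longlonglongrightarrow> 1 / (1 - 1 / 4 ^ p)"
    by (simp add: m_def)
  have count_le_m: "\<forall>\<^sub>F n in sequentially. count_le L (m n) = count_le L n"
    using eventually_compose_filterlim[OF large m_div]
  proof eventually_elim
    case (elim n)
    show ?case
    proof (cases "n mod p = 0")
      case True
      then have "m n = n" by (auto simp: m_def)
      then show ?thesis by simp
    next
      case False
      then show ?thesis
        using step[of "n div p" "n mod p"] elim p
        by (simp add: m_def mod_less_divisor less_imp_le) (metis mod_less_divisor less_irrefl)
    qed
  qed

  have limG: "(\<lambda>n. a n / a (m n) / 4 ^ (n mod p)) \<longlonglongrightarrow> 1"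
  proof (rule tendstoI)
    fix e :: real assume e: "e > 0"
    \<comment> \<open>The shift \<open>n mod p\<close> varies with \<open>n\<close>, so the
      convergence must be uniform in \<open>i\<close>; this holds because there are only finitely
      many residues.\<close>
    have "\<forall>\<^sub>F k in sequentially. \<forall>i\<in>{..<p}. dist (a (k + i) / a k / 4 ^ i) 1 < e"
    proof (rule eventually_ball_finite, simp, rule ballI)
      fix i
      have "(\<lambda>k. a (k + i) / a k / 4 ^ i) \<longlonglongrightarrow> 4 ^ i / 4 ^ i"
        by (intro tendsto_intros a_ratio) simp
      then show "\<forall>\<^sub>F k in sequentially. dist (a (k + i) / a k / 4 ^ i) 1 < e"
        using e by (intro tendstoD) simp_all
    qed
    from eventually_compose_filterlim[OF this m]
    show "\<forall>\<^sub>F n in sequentially. dist (a n / a (m n) / 4 ^ (n mod p)) 1 < e"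
    proof eventually_elim
      case (elim n)
      then have "dist (a (m n + n mod p) / a (m n) / 4 ^ (n mod p)) 1 < e"
        using p by simp
      then show ?case by (simp add: m_def)
    qed
  qed

  define c where "c = 1 - 1 / (4::real) ^ p"
  have "(4::real) ^ p > 1" using p by (simp add: one_less_power)
  then have c: "c > 0" by (simp add: c_def)
  \<comment> \<open>The values of \<open>a\<close> cancel, leaving the ratio of the counts times
    \<open>4 ^ (n mod p)\<close>. Its limit is \<open>(1 / c) / (4 / 3)\<close>, which the factor
    \<open>4 / 3 * c\<close> normalises to 1.\<close>
  have "(\<lambda>n. (real (count_le L (m n)) / a (m n)) / (real (count_le UNIV n) / a n)
      / (a n / a (m n) / 4 ^ (n mod p)) * (4 / 3 * c))
      \<longlonglongrightarrow> (1 / c) / (1 / (1 - 1 / 4)) / 1 * (4 / 3 * c)"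
    unfolding c_def by (intro tendsto_intros limL limM limG) simp_all
  then have lim: "(\<lambda>n. (real (count_le L (m n)) / a (m n)) / (real (count_le UNIV n) / a n)
      / (a n / a (m n) / 4 ^ (n mod p)) * (4 / 3 * c)) \<longlonglongrightarrow> 1"
    using c by simp
  \<comment> \<open>Cancelling \<open>a (m n)\<close> requires it to be nonzero, whereas
    \<open>a 0 = 0\<close>.\<close>
  have "\<forall>\<^sub>F n in sequentially. m n > 0"
    by (rule eventually_compose_filterlim[OF eventually_gt_at_top m])
  with count_le_m eventually_gt_at_top[of 0]
  have "\<forall>\<^sub>F n in sequentially. (real (count_le L (m n)) / a (m n)) / (real (count_le UNIV n) / a n)
      / (a n / a (m n) / 4 ^ (n mod p)) * (4 / 3 * c)
      = real (count_le L n) / real (count_le UNIV n) / (3 / (c * 4 ^ (1 + n mod p)))"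
  proof eventually_elim
    case (elim n)
    then have "a n > 0" "a (m n) > 0" by (auto intro: a_pos)
    with elim(1) c show ?case by (simp add: field_simps)
  qed
  with lim have "(\<lambda>n. real (count_le L n) / real (count_le UNIV n) / (3 / (c * 4 ^ (1 + n mod p))))
      \<longlonglongrightarrow> 1"
    by (rule Lim_transform_eventually)
  then have "(\<lambda>n. real (count_le L n) / real (count_le UNIV n))
      \<sim>[sequentially] (\<lambda>n. 3 / (c * 4 ^ (1 + n mod p)))"
    by (rule asymp_equivI')
  with p show ?thesis unfolding c_def by blast
qed

end
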